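(* Let $n=p^2$, where $p$ is an odd prime. Then the equation $$x^4+y^4+z^4-2x^2y^2-2y^2z^2-2z^2x^2=n$$ has exactly twenty-four integer solutions $(x,y,z)$, namely $$(\pm e,\pm f,0),\ (\pm e,0,\pm f),\ (0,\pm e,\pm f),\ (0,\pm f,\pm e),\ (\pm f,\pm e,0),\ (\pm f,0,\pm e),$$ where $e=\frac{p+1}{2}$, $f=\frac{p-1}{2}$, and where in each triple all four sign combinations occur. *)

theory Defs
  imports Complex_Main "HOL-Computational_Algebra.Primes"
begin

end

theory Submission
  imports Defs
begin

text \<open>
  The quartic form is the Heron polynomial up to sign: it splits into the four linear factors
  \<open>x + y + z\<close>, \<open>x - y - z\<close>, \<open>x + y - z\<close> and \<open>x - y + z\<close>. Since it is even in each variable,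
  one may take the variables nonnegative, so that \<open>x + y + z\<close> dominates the other three factors
  in absolute value and is one of the divisors 1, \<open>p\<close>, \<open>p\<^sup>2\<close> of \<open>p\<^sup>2\<close>. The value \<open>p\<^sup>2\<close> would force
  the remaining factors to be \<open>\<plusminus>1\<close>, although each factor is a signed sum of the other three.
  Otherwise \<open>x + y + z \<le> p\<close>, while \<open>p\<close> divides a second factor; but for positive variables the
  other factors are strictly smaller than \<open>x + y + z\<close> in absolute value, so one variable must
  vanish (\<open>heron_prime_square_imp_zero\<close>).

  With one variable zero the equation reads \<open>(x\<^sup>2 - y\<^sup>2)\<^sup>2 = p\<^sup>2\<close>, and the only factorization
  \<open>p = 1 \<cdot> p\<close> determines \<open>|x|\<close> and \<open>|y|\<close> up to order (\<open>square_diff_squares_eq_prime_square\<close>). The solutions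
  obtained are pairwise different because \<open>e = f + 1\<close> and \<open>f > 0\<close>, the latter as \<open>p \<ge> 3\<close>.
\<close>

lemma heron_factorization:
  fixes x y z :: int
  shows "x^4 + y^4 + z^4 - 2 * x^2 * y^2 - 2 * y^2 * z^2 - 2 * z^2 * x^2
    = (x + y + z) * ((x - y - z) * (x + y - z) * (x - y + z))"
  by algebra

lemma dvd_prime_square_int:
  fixes a p :: int
  assumes "prime p" "a dvd p^2" "a \<ge> 0"
  shows "a = 1 \<or> a = p \<or> a = p^2"
proof -
  obtain i where "i \<le> 2" "a = p ^ i"
    using assms divides_primepow[of p a 2] by auto
  moreover from this have "i = 0 \<or> i = 1 \<or> i = 2" by auto
  ultimately show ?thesis by auto
qed

text \<open>
  Nonnegativity makes \<open>x + y + z\<close> the largest factor, strictly so unless a variable is zero. If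
  it is at most \<open>p\<close>, strictness would leave no other factor that is large enough to be a nonzero
  multiple of \<open>p\<close>, and some factor besides it must be one.
\<close>

lemma heron_prime_square_imp_zero_nonneg:
  fixes x y z p :: int
  assumes p: "prime p" and nonneg: "x \<ge> 0" "y \<ge> 0" "z \<ge> 0"
    and eq: "(x + y + z) * ((x - y - z) * (x + y - z) * (x - y + z)) = p^2"
  shows "x = 0 \<or> y = 0 \<or> z = 0"
proof -
  let ?a = "x + y + z" and ?b = "x - y - z" and ?c = "x + y - z" and ?d = "x - y + z"
  have p2: "p \<ge> 2" using p by (rule prime_ge_2_int)
  have nz: "?b \<noteq> 0" "?c \<noteq> 0" "?d \<noteq> 0" using eq p2 by auto
  have "?a dvd p^2" using eq by (metis dvd_triv_left)
  then consider "?a = p^2" | "?a = 1 \<or> ?a = p"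
    using dvd_prime_square_int[OF p, of ?a] nonneg by linarith
  then show ?thesis
  proof cases
    case 1
    with eq p2 have "?b * ?c * ?d = 1" by simp
    then have "?b dvd 1" "?c dvd 1" "?d dvd 1"
      by (metis dvd_triv_right dvd_triv_left mult.assoc mult.commute)+
    then have "\<bar>?b\<bar> = 1" "\<bar>?c\<bar> = 1" "\<bar>?d\<bar> = 1" by simp_all
    \<comment> \<open>The largest factor is the combination \<open>c + d - b\<close> of the others.\<close>
    then have "p^2 \<le> 3" using 1 by linarith
    moreover have "p^2 \<ge> 2^2" using p2 by (intro power_mono) auto
    ultimately show ?thesis by simp
  next
    case 2
    have "p dvd ?b * ?c * ?d"
      using 2
    proof
      assume "?a = 1"
      then have "?b * ?c * ?d = p^2" using eq by simp
      then show ?thesis by (simp add: power2_eq_square)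
    next
      assume "?a = p"
      then have "?b * ?c * ?d = p" using eq p2 by (simp add: power2_eq_square)
      then show ?thesis by simp
    qed
    then have "p dvd ?b \<or> p dvd ?c \<or> p dvd ?d"
      using p by (simp add: prime_dvd_mult_iff)
    moreover have "p \<le> \<bar>u\<bar>" if "p dvd u" "u \<noteq> 0" for u
      using dvd_imp_le_int[OF that(2,1)] p2 by simp
    ultimately have large: "p \<le> \<bar>?b\<bar> \<or> p \<le> \<bar>?c\<bar> \<or> p \<le> \<bar>?d\<bar>"
      using nz by blast
    show ?thesis
    proof (rule ccontr)
      assume "\<not> ?thesis"
      then have "x > 0" "y > 0" "z > 0" using nonneg by auto
      then have "\<bar>?b\<bar> < ?a" "\<bar>?c\<bar> < ?a" "\<bar>?d\<bar> < ?a" by linarith+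
      moreover have "?a \<le> p" using 2 p2 by linarith
      ultimately show False using large by linarith
    qed
  qed
qed

lemma heron_prime_square_imp_zero:
  fixes x y z p :: int
  assumes "prime p"
    and eq: "x^4 + y^4 + z^4 - 2 * x^2 * y^2 - 2 * y^2 * z^2 - 2 * z^2 * x^2 = p^2"
  shows "x = 0 \<or> y = 0 \<or> z = 0"
proof -
  have "\<bar>x\<bar>^4 + \<bar>y\<bar>^4 + \<bar>z\<bar>^4 - 2 * \<bar>x\<bar>^2 * \<bar>y\<bar>^2 - 2 * \<bar>y\<bar>^2 * \<bar>z\<bar>^2 - 2 * \<bar>z\<bar>^2 * \<bar>x\<bar>^2 = p^2"
    using eq by (simp add: power_even_abs)
  then have "\<bar>x\<bar> = 0 \<or> \<bar>y\<bar> = 0 \<or> \<bar>z\<bar> = 0"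
    unfolding heron_factorization
    by (intro heron_prime_square_imp_zero_nonneg[OF assms(1)]) auto
  then show ?thesis by simp
qed

lemma diff_squares_eq_prime:
  fixes x y f :: int
  assumes p: "prime (2 * f + 1)" and eq: "x^2 - y^2 = 2 * f + 1"
  shows "\<bar>x\<bar> = f + 1 \<and> \<bar>y\<bar> = f"
proof -
  let ?p = "2 * f + 1"
  have p2: "?p \<ge> 2" using p by (rule prime_ge_2_int)
  have "\<bar>x\<bar>^2 - \<bar>y\<bar>^2 = ?p" using eq by simp
  then have prod: "(\<bar>x\<bar> + \<bar>y\<bar>) * (\<bar>x\<bar> - \<bar>y\<bar>) = ?p"
    by (simp add: power2_eq_square algebra_simps)
  have "\<bar>x\<bar> + \<bar>y\<bar> dvd ?p" using prod by (metis dvd_triv_left)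
  then have "\<bar>x\<bar> + \<bar>y\<bar> = 1 \<or> \<bar>x\<bar> + \<bar>y\<bar> = ?p"
    using p by (simp add: prime_int_iff)
  then show ?thesis
  proof
    assume s: "\<bar>x\<bar> + \<bar>y\<bar> = 1"
    then have "\<bar>x\<bar> - \<bar>y\<bar> = ?p" using prod by simp
    then show ?thesis using s p2 by linarith
  next
    assume s: "\<bar>x\<bar> + \<bar>y\<bar> = ?p"
    then have "\<bar>x\<bar> - \<bar>y\<bar> = 1" using prod p2 by simp
    then show ?thesis using s by linarith
  qed
qed

lemma square_diff_squares_eq_prime_square:
  fixes x y f :: int
  assumes p: "prime (2 * f + 1)"
  shows "(x^2 - y^2)^2 = (2 * f + 1)^2
    \<longleftrightarrow> (\<bar>x\<bar> = f + 1 \<and> \<bar>y\<bar> = f) \<or> (\<bar>x\<bar> = f \<and> \<bar>y\<bar> = f + 1)"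
    (is "?L \<longleftrightarrow> ?R")
proof
  assume ?L
  then have "x^2 - y^2 = 2 * f + 1 \<or> y^2 - x^2 = 2 * f + 1"
    by (auto simp: power2_eq_iff)
  then show ?R
    using diff_squares_eq_prime[OF p, of x y] diff_squares_eq_prime[OF p, of y x] by blast
next
  have succ_diff: "(f + 1)^2 - f^2 = 2 * f + 1"
    by (simp add: power2_eq_square algebra_simps)
  assume ?R
  then have "x^2 = (f + 1)^2 \<and> y^2 = f^2 \<or> x^2 = f^2 \<and> y^2 = (f + 1)^2"
    by (metis power2_abs)
  then show ?L
    using succ_diff power2_commute[of "x^2" "y^2"] by auto
qed

definition signed_arrangements :: "int \<Rightarrow> int \<Rightarrow> (int \<times> int \<times> int) set" where
  "signed_arrangements e f = (\<Union>s\<in>{1, -1}. \<Union>t\<in>{1, -1}.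
     {(s * e, t * f, 0), (s * e, 0, t * f), (0, s * e, t * f),
      (0, s * f, t * e), (s * f, t * e, 0), (s * f, 0, t * e)})"

lemma mem_signed_arrangements_iff:
  assumes "e > 0" "f > 0"
  shows "(x, y, z) \<in> signed_arrangements e f \<longleftrightarrow>
      (z = 0 \<and> (\<bar>x\<bar> = e \<and> \<bar>y\<bar> = f \<or> \<bar>x\<bar> = f \<and> \<bar>y\<bar> = e))
    \<or> (y = 0 \<and> (\<bar>x\<bar> = e \<and> \<bar>z\<bar> = f \<or> \<bar>x\<bar> = f \<and> \<bar>z\<bar> = e))
    \<or> (x = 0 \<and> (\<bar>y\<bar> = e \<and> \<bar>z\<bar> = f \<or> \<bar>y\<bar> = f \<and> \<bar>z\<bar> = e))"
proof -
  \<comment> \<open>Hiding the two signs behind a name keeps the quantifiers over them intact, so that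
    the equivalence becomes one of pure logic instead of a comparison of 24 cases.\<close>
  define A where "A = {1, -1 :: int}"
  have abs: "\<bar>u\<bar> = e \<longleftrightarrow> (\<exists>s\<in>A. u = s * e)" "\<bar>u\<bar> = f \<longleftrightarrow> (\<exists>s\<in>A. u = s * f)" for u
    using assms unfolding A_def by auto
  show ?thesis
    unfolding signed_arrangements_def A_def[symmetric] abs UN_iff insert_iff empty_iff prod.inject
    by blast
qed

lemma card_signed_arrangements:
  assumes "e > 0" "f > 0" "e \<noteq> f"
  shows "card (signed_arrangements e f) = 24"
proof -
  have "e \<noteq> 0" "f \<noteq> 0" "f \<noteq> e" "e \<noteq> f" "- f \<noteq> e" "- e \<noteq> f" "f \<noteq> - e" "e \<noteq> - f"
    "- e \<noteq> e" "- f \<noteq> f" "e \<noteq> - e" "f \<noteq> - f"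
    using assms by linarith+
  then show ?thesis
    by (simp add: signed_arrangements_def card_insert_if)
qed

theorem theorem6:
  fixes p :: nat and n e f :: int and S :: "(int \<times> int \<times> int) set"
  assumes "prime p" and "odd p"
    and "n = (int p)^2"
    and "e = (int p + 1) div 2" and "f = (int p - 1) div 2"
    and "S = {(x, y, z). x^4 + y^4 + z^4 - 2 * x^2 * y^2 - 2 * y^2 * z^2 - 2 * z^2 * x^2 = n}"
  shows "S = (\<Union>s\<in>{1, -1}. \<Union>t\<in>{1, -1}.
                 {(s * e, t * f, 0), (s * e, 0, t * f), (0, s * e, t * f),
                  (0, s * f, t * e), (s * f, t * e, 0), (s * f, 0, t * e)})
         \<and> card S = 24"
proof -
  let ?Q = "\<lambda>x y z :: int. x^4 + y^4 + z^4 - 2 * x^2 * y^2 - 2 * y^2 * z^2 - 2 * z^2 * x^2"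
  let ?R = "\<lambda>u v :: int. (\<bar>u\<bar> = e \<and> \<bar>v\<bar> = f) \<or> (\<bar>u\<bar> = f \<and> \<bar>v\<bar> = e)"
  have pf: "int p = 2 * f + 1" and ef: "e = f + 1"
    using assms(2,4,5) by presburger+
  have prime: "prime (2 * f + 1)"
    using assms(1) pf by (metis prime_nat_int_transfer)
  have f_pos: "f > 0"
    using prime_ge_2_int[OF prime] by linarith
  have n: "n = (2 * f + 1)^2" using assms(3) pf by simp
  have two: "(u^2 - v^2)^2 = n \<longleftrightarrow> ?R u v" for u v
    unfolding n ef by (rule square_diff_squares_eq_prime_square[OF prime])
  have Q: "?Q u v 0 = (u^2 - v^2)^2" "?Q u 0 v = (u^2 - v^2)^2" "?Q 0 u v = (u^2 - v^2)^2" for u v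
    by (simp_all add: power2_eq_square power4_eq_xxxx algebra_simps)
  have zero: "?Q x y z = n \<Longrightarrow> x = 0 \<or> y = 0 \<or> z = 0" for x y z
    unfolding n by (rule heron_prime_square_imp_zero[OF prime])
  have cases:
    "?Q u v 0 = n \<longleftrightarrow> ?R u v" "?Q u 0 v = n \<longleftrightarrow> ?R u v" "?Q 0 u v = n \<longleftrightarrow> ?R u v" for u v
    unfolding Q by (rule two)+
  have sol: "?Q x y z = n \<longleftrightarrow>
      (z = 0 \<and> ?R x y) \<or> (y = 0 \<and> ?R x z) \<or> (x = 0 \<and> ?R y z)" (is "_ \<longleftrightarrow> ?rhs") for x y z
  proof
    assume Qn: "?Q x y z = n"
    from zero[OF Qn] show ?rhs
    proof (elim disjE)
      assume "x = 0" with Qn cases(3)[of y z] show ?rhs by blast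
    next
      assume "y = 0" with Qn cases(2)[of x z] show ?rhs by blast
    next
      assume "z = 0" with Qn cases(1)[of x y] show ?rhs by blast
    qed
  next
    assume ?rhs
    then show "?Q x y z = n"
      using cases(1)[of x y] cases(2)[of x z] cases(3)[of y z] by blast
  qed
  have e_pos: "e > 0" and e_ne_f: "e \<noteq> f" using f_pos ef by simp_all
  have "t \<in> S \<longleftrightarrow> t \<in> signed_arrangements e f" for t
  proof -
    obtain x y z where t: "t = (x, y, z)" by (cases t)
    show ?thesis
      unfolding t assms(6) mem_Collect_eq prod.case sol
      by (rule mem_signed_arrangements_iff[OF e_pos f_pos, symmetric])
  qed
  then have "S = signed_arrangements e f" by blast
  then show ?thesis
    using card_signed_arrangements[OF e_pos f_pos e_ne_f]
    unfolding signed_arrangements_def by simp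
qed

end
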